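(* Let $\mathbf S=(S,+,0,\delta)$ be a weak contact semilattice. Then the following conditions are equivalent. (1) $\mathbf S$ can be embedded into a Boolean algebra with overlap contact. (1$'$) $\mathbf S$ can be embedded into a Boolean algebra with additive contact. (2) $\mathbf S$ can be embedded into a distributive lattice with overlap contact. (2$'$) $\mathbf S$ can be embedded into an additive contact distributive lattice. (3) $\mathbf S$ satisfies both of the following conditions (D1) and (D2). (D1) For every $a,b,c_0,c_1\in S$, if $b\le a+c_0$, $b\le a+c_1$ and not $c_0\mathrel{\delta}c_1$, then $b\le a$. (D2) For every $n\in\mathbb N$ (including $n=0$) and all $a,b,c_{1,0},c_{1,1},\dots,c_{n,0},c_{n,1}\in S$: if $c_{i,0}\mathrel{\delta}c_{i,1}$ fails for every $i=1,\dots,n$, and if, for every function $f:\{1,\dots,n\}\to\{0,1\}$, either $b\le c_{1,f(1)}+\dots+c_{n,f(n)}$ or $a\le c_{1,f(1)}+\dots+c_{n,f(n)}$, then $b\mathrel{\delta}a$ fails. (An empty sum is evaluated to $0$.) (4) $\mathbf S$ can be embedded into a complete atomic Boolean algebra with overlap contact. (5) $\mathbf S$ can be embedded into the contact semilattice associated to some topological space. (6) $\mathbf S$ can be embedded into the contact semilattice associated to some distributive lattice with additive closure.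
   Context: Semilattices are join semilattices with a minimum element $0$; the operation is written $+$ and the order is $a\le b$ iff $a+b=b$. Distributive lattices are also assumed to have a minimum $0$. A weak contact relation on a poset with $0$ (in particular on a semilattice, distributive lattice or Boolean algebra, with its order) is a binary relation $\delta$ such that, for all elements: (Sym) $a\mathrel{\delta}b$ iff $b\mathrel{\delta}a$; (Emp) $a\mathrel{\delta}b$ implies $a>0$ and $b>0$; (Ext) $a\mathrel{\delta}b$, $a\le a_1$ and $b\le b_1$ imply $a_1\mathrel{\delta}b_1$; (Ref) $n\ne0$ implies $n\mathrel{\delta}n$. A weak contact semilattice is a structure $(S,+,0,\delta)$ where $(S,+,0)$ is a semilattice with $0$ and $\delta$ is a weak contact relation on it. A weak contact relation is additive if moreover $a\mathrel{\delta}b+c$ implies $a\mathrel{\delta}b$ or $a\mathrel{\delta}c$. "Additive contact distributive lattice" means a distributive lattice with an additive weak contact relation, and a Boolean algebra "with additive contact" is one with an additive weak contact relation. The overlap contact relation is defined by: $a\mathrel{\delta}b$ iff there is $n>0$ with $n\le a$ and $n\le b$. An embedding $\varphi$ of (weak) contact semilattices is an injective map preserving $0$ and $+$ such that $a\mathrel{\delta}b$ if and only if $\varphi(a)\mathrel{\delta}\varphi(b)$, for all $a,b$ in the domain. When $\mathbf S$ is said to be embedded into a Boolean algebra or distributive lattice with a contact relation, this means an embedding into its reduct in the language $\{+,0,\delta\}$, where $+$ is join; preservation of meets, complements, or a maximum is not required. If $X$ is a topological space with closure $K$, the associated contact semilattice is $(\mathcal P(X),\cup,\emptyset,\delta)$,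 where $a\mathrel{\delta}b$ iff $Ka\cap Kb\ne\emptyset$. More generally, for a poset $\mathbf P$ with $0$ and a closure operation $K$ (extensive, isotone, idempotent), the associated contact relation is: $a\mathrel{\delta}b$ iff there is $n\in P$, $n>0$, with $n\le Ka$ and $n\le Kb$. The contact semilattice associated to a distributive lattice with closure operation $K$ is its reduct $(+,0)$ with this associated relation. The closure is additive if $K(a+b)=Ka+Kb$ for all $a,b$, and $K0=0$. *)

theory Defs
  imports "HOL-Analysis.Abstract_Topology" "HOL-Algebra.Complete_Lattice"
begin

text \<open>
  Ordered structures are the carrier-based ones of HOL-Algebra, with order \<open>\<sqsubseteq>\<close>, join \<open>\<squnion>\<close> (the
  operation \<open>+\<close>), meet \<open>\<sqinter>\<close> and minimum \<open>\<bottom>\<close> (the element \<open>0\<close>). A contact relation is a separate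
  binary predicate, whose values outside the carrier are irrelevant.
\<close>

locale semilattice_bottom = upper_semilattice L + weak_partial_order_bottom L for L (structure)

locale distrib_lattice_bottom = lattice L + weak_partial_order_bottom L for L (structure) +
  assumes meet_join_distrib:
    "\<lbrakk>x \<in> carrier L; y \<in> carrier L; z \<in> carrier L\<rbrakk> \<Longrightarrow> x \<sqinter> (y \<squnion> z) = (x \<sqinter> y) \<squnion> (x \<sqinter> z)"

locale boolean_lattice = distrib_lattice_bottom L + weak_partial_order_top L for L (structure) +
  assumes complement_exists:
    "x \<in> carrier L \<Longrightarrow> \<exists>y\<in>carrier L. x \<sqinter> y = \<bottom> \<and> x \<squnion> y = \<top>"

definition atom_of :: "('a, 'm) gorder_scheme \<Rightarrow> 'a \<Rightarrow> bool" where
  "atom_of L p \<longleftrightarrow> p \<in> carrier L \<and> p \<noteq> \<bottom>\<^bsub>L\<^esub> \<and>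
     (\<forall>x\<in>carrier L. x \<sqsubseteq>\<^bsub>L\<^esub> p \<longrightarrow> x = \<bottom>\<^bsub>L\<^esub> \<or> x = p)"

locale complete_atomic_boolean_lattice =
  boolean_lattice L + complete_lattice L for L (structure) +
  assumes atomic: "\<lbrakk>x \<in> carrier L; x \<noteq> \<bottom>\<rbrakk> \<Longrightarrow> \<exists>p. atom_of L p \<and> p \<sqsubseteq> x"

locale weak_contact = partial_order L + weak_partial_order_bottom L
  for L (structure) and \<delta> :: "'a \<Rightarrow> 'a \<Rightarrow> bool" +
  assumes contact_sym: "\<lbrakk>a \<in> carrier L; b \<in> carrier L\<rbrakk> \<Longrightarrow> \<delta> a b \<longleftrightarrow> \<delta> b a"
    and contact_emp: "\<lbrakk>a \<in> carrier L; b \<in> carrier L; \<delta> a b\<rbrakk> \<Longrightarrow> \<bottom> \<sqsubset> a \<and> \<bottom> \<sqsubset> b"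
    and contact_ext:
      "\<lbrakk>a \<in> carrier L; b \<in> carrier L; a' \<in> carrier L; b' \<in> carrier L;
        \<delta> a b; a \<sqsubseteq> a'; b \<sqsubseteq> b'\<rbrakk> \<Longrightarrow> \<delta> a' b'"
    and contact_ref: "\<lbrakk>n \<in> carrier L; n \<noteq> \<bottom>\<rbrakk> \<Longrightarrow> \<delta> n n"

locale weak_contact_semilattice = semilattice_bottom L + weak_contact L \<delta>
  for L (structure) and \<delta>

locale additive_contact_semilattice = weak_contact_semilattice L \<delta> for L (structure) and \<delta> +
  assumes contact_additive:
    "\<lbrakk>a \<in> carrier L; b \<in> carrier L; c \<in> carrier L; \<delta> a (b \<squnion> c)\<rbrakk> \<Longrightarrow> \<delta> a b \<or> \<delta> a c"

definition overlap :: "('a, 'm) gorder_scheme \<Rightarrow> 'a \<Rightarrow> 'a \<Rightarrow> bool" where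
  "overlap L a b \<longleftrightarrow> (\<exists>n\<in>carrier L. \<bottom>\<^bsub>L\<^esub> \<sqsubset>\<^bsub>L\<^esub> n \<and> n \<sqsubseteq>\<^bsub>L\<^esub> a \<and> n \<sqsubseteq>\<^bsub>L\<^esub> b)"

definition closure_operation :: "('a, 'm) gorder_scheme \<Rightarrow> ('a \<Rightarrow> 'a) \<Rightarrow> bool" where
  "closure_operation L K \<longleftrightarrow> K \<in> carrier L \<rightarrow> carrier L \<and>
     (\<forall>x\<in>carrier L. x \<sqsubseteq>\<^bsub>L\<^esub> K x) \<and> isotone L L K \<and> idempotent L K"

definition additive_closure :: "('a, 'm) gorder_scheme \<Rightarrow> ('a \<Rightarrow> 'a) \<Rightarrow> bool" where
  "additive_closure L K \<longleftrightarrow> closure_operation L K \<and>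
     (\<forall>a\<in>carrier L. \<forall>b\<in>carrier L. K (a \<squnion>\<^bsub>L\<^esub> b) = K a \<squnion>\<^bsub>L\<^esub> K b) \<and> K \<bottom>\<^bsub>L\<^esub> = \<bottom>\<^bsub>L\<^esub>"

definition closure_contact ::
  "('a, 'm) gorder_scheme \<Rightarrow> ('a \<Rightarrow> 'a) \<Rightarrow> 'a \<Rightarrow> 'a \<Rightarrow> bool" where
  "closure_contact L K a b \<longleftrightarrow>
     (\<exists>n\<in>carrier L. \<bottom>\<^bsub>L\<^esub> \<sqsubset>\<^bsub>L\<^esub> n \<and> n \<sqsubseteq>\<^bsub>L\<^esub> K a \<and> n \<sqsubseteq>\<^bsub>L\<^esub> K b)"

definition powerset_lattice :: "'a set \<Rightarrow> 'a set gorder" where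
  "powerset_lattice X = \<lparr>carrier = Pow X, eq = (=), le = (\<subseteq>)\<rparr>"

definition topology_contact :: "'a topology \<Rightarrow> 'a set \<Rightarrow> 'a set \<Rightarrow> bool" where
  "topology_contact X a b \<longleftrightarrow> X closure_of a \<inter> X closure_of b \<noteq> {}"

text \<open>
  Only \<open>0\<close>, \<open>+\<close> and the contact are preserved, so that a map into a lattice with a contact
  relation is a map into its \<open>(+, 0, \<delta>)\<close>-reduct.
\<close>

definition contact_embedding ::
  "('a, 'm) gorder_scheme \<Rightarrow> ('a \<Rightarrow> 'a \<Rightarrow> bool) \<Rightarrow>
   ('b, 'n) gorder_scheme \<Rightarrow> ('b \<Rightarrow> 'b \<Rightarrow> bool) \<Rightarrow> ('a \<Rightarrow> 'b) \<Rightarrow> bool" where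
  "contact_embedding S \<delta> T \<epsilon> \<phi> \<longleftrightarrow>
     \<phi> \<in> carrier S \<rightarrow> carrier T \<and> inj_on \<phi> (carrier S) \<and> \<phi> \<bottom>\<^bsub>S\<^esub> = \<bottom>\<^bsub>T\<^esub> \<and>
     (\<forall>a\<in>carrier S. \<forall>b\<in>carrier S. \<phi> (a \<squnion>\<^bsub>S\<^esub> b) = \<phi> a \<squnion>\<^bsub>T\<^esub> \<phi> b) \<and>
     (\<forall>a\<in>carrier S. \<forall>b\<in>carrier S. \<delta> a b \<longleftrightarrow> \<epsilon> (\<phi> a) (\<phi> b))"

definition embeddable ::
  "('a, 'm) gorder_scheme \<Rightarrow> ('a \<Rightarrow> 'a \<Rightarrow> bool) \<Rightarrow>
   ('b, 'n) gorder_scheme \<Rightarrow> ('b \<Rightarrow> 'b \<Rightarrow> bool) \<Rightarrow> bool" where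
  "embeddable S \<delta> T \<epsilon> \<longleftrightarrow> (\<exists>\<phi>. contact_embedding S \<delta> T \<epsilon> \<phi>)"

text \<open>
  A formula of HOL cannot quantify over types, so the embeddability conditions carry as a parameter
  the type \<open>'u\<close> from which the elements of the target structure (the points, in the case of
  topological spaces) are taken. Targets are carried by arbitrary subsets of \<open>'u\<close>.
  The type \<open>'a set set\<close> is large enough to represent a semilattice with carrier in \<open>'a\<close>, by families
  of ideals; unrestricted embeddability therefore means that a target in \<open>'a set set\<close> exists, given
  that a target in an arbitrary type \<open>'u\<close> leads to no weaker condition on the semilattice.
\<close>

definition embeds_boolean_overlap ::
  "'u itself \<Rightarrow> ('a, 'm) gorder_scheme \<Rightarrow> ('a \<Rightarrow> 'a \<Rightarrow> bool) \<Rightarrow> bool" where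
  "embeds_boolean_overlap U S \<delta> \<longleftrightarrow>
     (\<exists>B :: 'u gorder. boolean_lattice B \<and> embeddable S \<delta> B (overlap B))"

definition embeds_boolean_additive ::
  "'u itself \<Rightarrow> ('a, 'm) gorder_scheme \<Rightarrow> ('a \<Rightarrow> 'a \<Rightarrow> bool) \<Rightarrow> bool" where
  "embeds_boolean_additive U S \<delta> \<longleftrightarrow>
     (\<exists>(B :: 'u gorder) \<epsilon>. boolean_lattice B \<and> additive_contact_semilattice B \<epsilon> \<and>
        embeddable S \<delta> B \<epsilon>)"

definition embeds_distrib_overlap ::
  "'u itself \<Rightarrow> ('a, 'm) gorder_scheme \<Rightarrow> ('a \<Rightarrow> 'a \<Rightarrow> bool) \<Rightarrow> bool" where
  "embeds_distrib_overlap U S \<delta> \<longleftrightarrow>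
     (\<exists>L :: 'u gorder. distrib_lattice_bottom L \<and> embeddable S \<delta> L (overlap L))"

definition embeds_distrib_additive ::
  "'u itself \<Rightarrow> ('a, 'm) gorder_scheme \<Rightarrow> ('a \<Rightarrow> 'a \<Rightarrow> bool) \<Rightarrow> bool" where
  "embeds_distrib_additive U S \<delta> \<longleftrightarrow>
     (\<exists>(L :: 'u gorder) \<epsilon>. distrib_lattice_bottom L \<and> additive_contact_semilattice L \<epsilon> \<and>
        embeddable S \<delta> L \<epsilon>)"

definition embeds_complete_atomic_overlap ::
  "'u itself \<Rightarrow> ('a, 'm) gorder_scheme \<Rightarrow> ('a \<Rightarrow> 'a \<Rightarrow> bool) \<Rightarrow> bool" where
  "embeds_complete_atomic_overlap U S \<delta> \<longleftrightarrow>
     (\<exists>B :: 'u gorder. complete_atomic_boolean_lattice B \<and> embeddable S \<delta> B (overlap B))"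

definition embeds_topological ::
  "'u itself \<Rightarrow> ('a, 'm) gorder_scheme \<Rightarrow> ('a \<Rightarrow> 'a \<Rightarrow> bool) \<Rightarrow> bool" where
  "embeds_topological U S \<delta> \<longleftrightarrow>
     (\<exists>X :: 'u topology. embeddable S \<delta> (powerset_lattice (topspace X)) (topology_contact X))"

definition embeds_distrib_closure ::
  "'u itself \<Rightarrow> ('a, 'm) gorder_scheme \<Rightarrow> ('a \<Rightarrow> 'a \<Rightarrow> bool) \<Rightarrow> bool" where
  "embeds_distrib_closure U S \<delta> \<longleftrightarrow>
     (\<exists>(L :: 'u gorder) K. distrib_lattice_bottom L \<and> additive_closure L K \<and>
        embeddable S \<delta> L (closure_contact L K))"

definition D1 :: "('a, 'm) gorder_scheme \<Rightarrow> ('a \<Rightarrow> 'a \<Rightarrow> bool) \<Rightarrow> bool" where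
  "D1 S \<delta> \<longleftrightarrow>
     (\<forall>a\<in>carrier S. \<forall>b\<in>carrier S. \<forall>c0\<in>carrier S. \<forall>c1\<in>carrier S.
        b \<sqsubseteq>\<^bsub>S\<^esub> a \<squnion>\<^bsub>S\<^esub> c0 \<longrightarrow> b \<sqsubseteq>\<^bsub>S\<^esub> a \<squnion>\<^bsub>S\<^esub> c1 \<longrightarrow> \<not> \<delta> c0 c1 \<longrightarrow> b \<sqsubseteq>\<^bsub>S\<^esub> a)"

text \<open>\<open>join_upto S g n\<close> is \<open>g 1 + \<dots> + g n\<close>; for \<open>n = 0\<close> it is \<open>0\<close>.\<close>

primrec join_upto :: "('a, 'm) gorder_scheme \<Rightarrow> (nat \<Rightarrow> 'a) \<Rightarrow> nat \<Rightarrow> 'a" where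
  "join_upto S g 0 = \<bottom>\<^bsub>S\<^esub>"
| "join_upto S g (Suc n) = join_upto S g n \<squnion>\<^bsub>S\<^esub> g (Suc n)"

definition D2 :: "('a, 'm) gorder_scheme \<Rightarrow> ('a \<Rightarrow> 'a \<Rightarrow> bool) \<Rightarrow> bool" where
  "D2 S \<delta> \<longleftrightarrow>
     (\<forall>n. \<forall>a\<in>carrier S. \<forall>b\<in>carrier S. \<forall>c :: nat \<Rightarrow> nat \<Rightarrow> 'a.
        (\<forall>i\<in>{1..n}. c i 0 \<in> carrier S \<and> c i 1 \<in> carrier S) \<longrightarrow>
        (\<forall>i\<in>{1..n}. \<not> \<delta> (c i 0) (c i 1)) \<longrightarrow>
        (\<forall>f \<in> {1..n} \<rightarrow> {0, 1}.
           b \<sqsubseteq>\<^bsub>S\<^esub> join_upto S (\<lambda>i. c i (f i)) n \<or> a \<sqsubseteq>\<^bsub>S\<^esub> join_upto S (\<lambda>i. c i (f i)) n) \<longrightarrow>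
        \<not> \<delta> b a)"

end

theory Submission
  imports Defs
begin

text \<open>
  The whole theorem rests on one kind of point. Suppose that \<open>S\<close> sits in a powerset with overlap
  contact, by a map \<open>\<phi>\<close>. Every point \<open>x\<close> then determines the ideal of all \<open>a\<close> with \<open>x \<notin> \<phi> a\<close>, and this
  ideal meets every pair \<open>c0, c1\<close> that is not in contact, since \<open>\<phi> c0\<close> and \<open>\<phi> c1\<close> are disjoint.
  Conversely, take all ideals with this property (\<open>clan_ideal\<close>; their complements are the clans of
  contact algebra) as points, and let \<open>\<phi> a\<close> be the set of those that omit \<open>a\<close>. Then \<open>\<phi>\<close> preserves
  \<open>0\<close> and \<open>+\<close>, and elements with overlapping images are in contact. It remains that \<open>\<phi>\<close> is
  injective, which needs for \<open>b \<notin> \<down>a\<close> a clan ideal that contains \<open>a\<close> and omits \<open>b\<close>, and that elements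
  in contact have overlapping images, which needs a clan ideal that omits both.

  Both existence statements follow from a single application of Zorn's lemma,
  \<open>clan_ideal_avoiding\<close>. The sets to be avoided are the upward closed sets \<open>T\<close> for which
  \<open>j + c0 \<in> T\<close> and \<open>j + c1 \<in> T\<close> with \<open>c0, c1\<close> not in contact force \<open>j \<in> T\<close> (\<open>splitting_closed\<close>): an
  ideal that is maximal among those disjoint from such a \<open>T\<close> is a clan ideal. Condition (D1) says
  that every principal filter is such a set, and (D2) implies, for \<open>a, b\<close> in contact, that the least
  such set containing \<open>a\<close> and \<open>b\<close> does not contain \<open>0\<close>.

  For the other direction, each of the embeddability conditions produces an embedding into a
  distributive lattice with additive contact. Indeed overlap is the contact of the identity
  closure, the contact of a topological space is the one of its closure on the powerset, and the
  contact of an additive closure on a distributive lattice is additive. An embedding reflects the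
  order and the contact, so it pulls (D1) and (D2) back, and only distributive lattices with
  additive contact are left. There (D1) holds because elements not in contact have meet \<open>0\<close>. For (D2),
  call \<open>b\<close> and \<open>a\<close> apart modulo \<open>j\<close> if they are below \<open>j + p\<close> and \<open>j + q\<close> for some \<open>p, q\<close> not in
  contact, that is, if what remains of them outside \<open>j\<close> is not in contact. The set of these \<open>j\<close> is
  splitting closed (\<open>splitting_closed_apart_modulo\<close>), and under the hypotheses of (D2) it contains
  every sum \<open>c 1 (f 1) + \<dots> + c n (f n)\<close>. Removing the pairs one at a time shows that it contains
  \<open>0\<close>, so that \<open>b\<close> and \<open>a\<close> are not in contact.
\<close>

section \<open>Semilattices with a weak contact\<close>

lemma (in upper_semilattice) le_iff_join_eq:
  assumes "x \<in> carrier L" "y \<in> carrier L"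
  shows "x \<sqsubseteq> y \<longleftrightarrow> x \<squnion> y = y"
  using assms by (metis join_closed join_le join_left join_right le_antisym le_refl)

lemma (in upper_semilattice) join_mono:
  assumes "x \<sqsubseteq> x'" "y \<sqsubseteq> y'"
    and "x \<in> carrier L" "x' \<in> carrier L" "y \<in> carrier L" "y' \<in> carrier L"
  shows "x \<squnion> y \<sqsubseteq> x' \<squnion> y'"
  using assms by (meson join_closed join_le join_left join_right le_trans)

lemma (in semilattice_bottom) join_upto_closed:
  assumes "\<And>i. i \<in> {1..n} \<Longrightarrow> g i \<in> carrier L"
  shows "join_upto L g n \<in> carrier L"
  using assms by (induction n) auto

lemma (in semilattice_bottom) join_upto_upper:
  assumes "\<And>i. i \<in> {1..n} \<Longrightarrow> g i \<in> carrier L" and "i \<in> {1..n}"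
  shows "g i \<sqsubseteq> join_upto L g n"
  using assms
proof (induction n)
  case (Suc n)
  have cl: "join_upto L g n \<in> carrier L" "g (Suc n) \<in> carrier L"
    using Suc.prems(1) by (auto intro: join_upto_closed)
  show ?case
  proof (cases "i = Suc n")
    case True
    then show ?thesis using cl by (simp add: join_right)
  next
    case False
    then have "i \<in> {1..n}" using Suc.prems(2) by auto
    then have "g i \<sqsubseteq> join_upto L g n" using Suc by auto
    moreover have "g i \<in> carrier L" using Suc.prems by blast
    ultimately show ?thesis
      using cl by simp (meson join_closed join_left le_trans)
  qed
qed simp

lemma join_upto_cong:
  assumes "\<And>i. i \<in> {1..n} \<Longrightarrow> g i = h i"
  shows "join_upto L g n = join_upto L h n"
  using assms by (induction n) auto

context weak_contact_semilattice
begin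

text \<open>
  The second condition is a resolution rule: \<open>c0\<close> and \<open>c1\<close> behave like disjoint sets, so a property
  of \<open>j\<close> that survives the addition of either of them should already hold of \<open>j\<close>.
\<close>

definition splitting_closed :: "'a set \<Rightarrow> bool" where
  "splitting_closed T \<longleftrightarrow>
     (\<forall>x\<in>carrier L. \<forall>y\<in>carrier L. x \<in> T \<longrightarrow> x \<sqsubseteq> y \<longrightarrow> y \<in> T) \<and>
     (\<forall>j\<in>carrier L. \<forall>c0\<in>carrier L. \<forall>c1\<in>carrier L.
        \<not> \<delta> c0 c1 \<longrightarrow> j \<squnion> c0 \<in> T \<longrightarrow> j \<squnion> c1 \<in> T \<longrightarrow> j \<in> T)"

text \<open>
  The whole carrier is allowed as a clan ideal. As a point it lies in the image of no element,
  so it does no harm.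
\<close>

definition clan_ideal :: "'a set \<Rightarrow> bool" where
  "clan_ideal I \<longleftrightarrow> I \<subseteq> carrier L \<and> \<bottom> \<in> I \<and>
     (\<forall>x\<in>carrier L. \<forall>y\<in>carrier L. x \<squnion> y \<in> I \<longleftrightarrow> x \<in> I \<and> y \<in> I) \<and>
     (\<forall>c0\<in>carrier L. \<forall>c1\<in>carrier L. \<not> \<delta> c0 c1 \<longrightarrow> c0 \<in> I \<or> c1 \<in> I)"

lemma splitting_closed_upward:
  "\<lbrakk>splitting_closed T; x \<in> T; x \<sqsubseteq> y; x \<in> carrier L; y \<in> carrier L\<rbrakk> \<Longrightarrow> y \<in> T"
  unfolding splitting_closed_def by blast

lemma splitting_closed_split:
  "\<lbrakk>splitting_closed T; \<not> \<delta> c0 c1; j \<squnion> c0 \<in> T; j \<squnion> c1 \<in> T;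
    j \<in> carrier L; c0 \<in> carrier L; c1 \<in> carrier L\<rbrakk> \<Longrightarrow> j \<in> T"
  unfolding splitting_closed_def by blast

text \<open>
  The pairs are resolved away from the last to the first: for a choice on the first \<open>n\<close> pairs, both
  of its extensions to pair \<open>n + 1\<close> are available. This is how the uniform family of sums in (D2) is
  turned into single resolution steps.
\<close>

lemma bottom_in_splitting_closed:
  fixes c :: "nat \<Rightarrow> nat \<Rightarrow> 'a"
  assumes T: "splitting_closed T"
    and "\<forall>i\<in>{1..n}. c i 0 \<in> carrier L \<and> c i 1 \<in> carrier L"
    and "\<forall>i\<in>{1..n}. \<not> \<delta> (c i 0) (c i 1)"
    and "\<forall>f \<in> {1..n} \<rightarrow> {0, 1}. join_upto L (\<lambda>i. c i (f i)) n \<in> T"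
  shows "\<bottom> \<in> T"
  using assms(2-)
proof (induction n)
  case (Suc n)
  have "join_upto L (\<lambda>i. c i (f i)) n \<in> T" if f: "f \<in> {1..n} \<rightarrow> {0::nat, 1}" for f
  proof -
    let ?J = "join_upto L (\<lambda>i. c i (f i)) n"
    have J: "?J \<in> carrier L"
    proof (rule join_upto_closed)
      fix i assume i: "i \<in> {1..n}"
      then have "f i = 0 \<or> f i = 1" using f by blast
      then show "c i (f i) \<in> carrier L" using Suc.prems(1) i by auto
    qed
    have ext: "?J \<squnion> c (Suc n) e \<in> T" if "e = 0 \<or> e = 1" for e
    proof -
      let ?f = "f(Suc n := e)"
      have "?f \<in> {1..Suc n} \<rightarrow> {0, 1}"
        using f that by (auto simp: Pi_iff)
      then have "join_upto L (\<lambda>i. c i (?f i)) (Suc n) \<in> T"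
        using Suc.prems(3) by blast
      moreover have "join_upto L (\<lambda>i. c i (?f i)) n = ?J"
        by (rule join_upto_cong) auto
      ultimately show ?thesis by simp
    qed
    show ?thesis
      using splitting_closed_split[OF T _ ext[of 0] ext[of 1] J] Suc.prems(1,2) by auto
  qed
  then show ?case using Suc by auto
qed simp

text \<open>
  An ideal \<open>M\<close> maximal among those that contain \<open>x\<close> and avoid \<open>T\<close> is a clan ideal. If it contains
  neither \<open>c0\<close> nor \<open>c1\<close>, adding either of them creates an element of \<open>T\<close>, so \<open>j0 + c0\<close> and \<open>j1 + c1\<close>
  are in \<open>T\<close> for some \<open>j0, j1 \<in> M\<close>. If \<open>c0, c1\<close> are not in contact, then \<open>j0 + j1 \<in> M\<close> would be in \<open>T\<close>.
\<close>

lemma clan_ideal_avoiding: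
  assumes T: "splitting_closed T" and x: "x \<in> carrier L" "x \<notin> T"
  shows "\<exists>I. clan_ideal I \<and> x \<in> I \<and> I \<inter> T = {}"
proof -
  define ideals where
    "ideals = {I. I \<subseteq> carrier L \<and> x \<in> I \<and> I \<inter> T = {} \<and>
       (\<forall>y\<in>I. \<forall>z\<in>carrier L. z \<sqsubseteq> y \<longrightarrow> z \<in> I) \<and> (\<forall>y\<in>I. \<forall>z\<in>I. y \<squnion> z \<in> I)}"
  note up = splitting_closed_upward[OF T] and split = splitting_closed_split[OF T]
  have principal: "{y \<in> carrier L. y \<sqsubseteq> x} \<in> ideals"
  proof -
    have "y \<notin> T" if "y \<in> carrier L" "y \<sqsubseteq> x" for y
      using that x up[of y x] by blast
    moreover have "z \<sqsubseteq> x" if "y \<in> carrier L" "y \<sqsubseteq> x" "z \<in> carrier L" "z \<sqsubseteq> y" for y z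
      using that(4,2,3,1) x(1) by (rule le_trans)
    moreover have "y \<squnion> z \<sqsubseteq> x"
      if "y \<in> carrier L" "y \<sqsubseteq> x" "z \<in> carrier L" "z \<sqsubseteq> x" for y z
      using that(2,4,1,3) x(1) by (rule join_le)
    ultimately show ?thesis
      unfolding ideals_def using x(1) le_refl[OF x(1)] join_closed
      by (intro CollectI conjI ballI impI) blast+
  qed
  have "\<exists>M\<in>ideals. \<forall>I\<in>ideals. M \<subseteq> I \<longrightarrow> I = M"
  proof (rule subset_Zorn_nonempty)
    show "ideals \<noteq> {}" using principal by auto
  next
    fix C assume "C \<noteq> {}" and C: "subset.chain ideals C"
    then have sub: "C \<subseteq> ideals" unfolding subset.chain_def by blast
    have "y \<squnion> z \<in> \<Union>C" if yz: "y \<in> \<Union>C" "z \<in> \<Union>C" for y z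
    proof -
      obtain A B where "A \<in> C" "B \<in> C" "y \<in> A" "z \<in> B" using yz by blast
      moreover from this have "A \<subseteq> B \<or> B \<subseteq> A"
        using C unfolding subset_chain_def by blast
      ultimately obtain D where "D \<in> C" "y \<in> D" "z \<in> D" by blast
      then show ?thesis using sub unfolding ideals_def by blast
    qed
    moreover have "\<Union>C \<subseteq> carrier L" "\<Union>C \<inter> T = {}" "x \<in> \<Union>C"
      using sub \<open>C \<noteq> {}\<close> unfolding ideals_def by blast+
    moreover have "\<forall>y\<in>\<Union>C. \<forall>z\<in>carrier L. z \<sqsubseteq> y \<longrightarrow> z \<in> \<Union>C"
      using sub unfolding ideals_def by blast
    ultimately show "\<Union>C \<in> ideals" unfolding ideals_def by simp
  qed
  then obtain M where M: "M \<in> ideals" and max: "\<And>I. I \<in> ideals \<Longrightarrow> M \<subseteq> I \<Longrightarrow> I = M" by blast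
  have Mc: "M \<subseteq> carrier L" and xM: "x \<in> M" and MT: "M \<inter> T = {}"
    and down: "\<forall>y\<in>M. \<forall>z\<in>carrier L. z \<sqsubseteq> y \<longrightarrow> z \<in> M"
    and join: "\<forall>y\<in>M. \<forall>z\<in>M. y \<squnion> z \<in> M"
    using M unfolding ideals_def by simp_all
  have hits_T: "\<exists>j\<in>M. j \<squnion> c \<in> T" if c: "c \<in> carrier L" "c \<notin> M" for c
  proof (rule ccontr)
    assume none: "\<not> ?thesis"
    define N where "N = {y \<in> carrier L. \<exists>j\<in>M. y \<sqsubseteq> j \<squnion> c}"
    have N_E: "\<exists>j\<in>M. y \<in> carrier L \<and> j \<in> carrier L \<and> j \<squnion> c \<in> carrier L \<and> y \<sqsubseteq> j \<squnion> c" if y: "y \<in> N" for y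
    proof -
      obtain j where "j \<in> M" "y \<in> carrier L" "y \<sqsubseteq> j \<squnion> c" using y unfolding N_def by blast
      moreover from this have "j \<in> carrier L" using Mc by blast
      ultimately show ?thesis using c(1) by (intro bexI[of _ j]) auto
    qed
    have N_I: "y \<in> N" if "j \<in> M" "y \<in> carrier L" "y \<sqsubseteq> j \<squnion> c" for y j
      using that unfolding N_def by auto
    have "y \<notin> T" if "y \<in> N" for y
      using N_E[OF that] up none by blast
    moreover have "y \<squnion> z \<in> N" if yz: "y \<in> N" "z \<in> N" for y z
    proof -
      obtain j where j: "j \<in> M" "y \<sqsubseteq> j \<squnion> c" "y \<in> carrier L" "j \<in> carrier L"
        using N_E[OF yz(1)] by blast
      obtain k where k: "k \<in> M" "z \<sqsubseteq> k \<squnion> c" "z \<in> carrier L" "k \<in> carrier L"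
        using N_E[OF yz(2)] by blast
      have "j \<squnion> c \<sqsubseteq> (j \<squnion> k) \<squnion> c" "k \<squnion> c \<sqsubseteq> (j \<squnion> k) \<squnion> c"
        using j k c by (auto intro!: join_mono simp: join_left join_right)
      then have "y \<sqsubseteq> (j \<squnion> k) \<squnion> c" "z \<sqsubseteq> (j \<squnion> k) \<squnion> c"
        using j k c(1) by (meson join_closed le_trans)+
      then show ?thesis using j k c(1) join by (intro N_I[of "j \<squnion> k"]) (auto intro!: join_le)
    qed
    moreover have "z \<in> N" if z: "y \<in> N" "z \<in> carrier L" "z \<sqsubseteq> y" for y z
      using N_E[OF z(1)] z(2,3) N_I le_trans by blast
    moreover have MN: "M \<subseteq> N"
    proof
      fix y assume y: "y \<in> M"
      then have "y \<in> carrier L" using Mc by blast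
      then show "y \<in> N" using y c(1) join_left N_I by blast
    qed
    moreover have "N \<subseteq> carrier L" unfolding N_def by blast
    ultimately have "N \<in> ideals"
      using xM unfolding ideals_def by (intro CollectI conjI ballI impI) blast+
    then have "N = M" using max MN by blast
    moreover have "c \<in> N" using xM c(1) x(1) join_right N_I by blast
    ultimately show False using c(2) by blast
  qed
  have "c0 \<in> M \<or> c1 \<in> M" if c: "c0 \<in> carrier L" "c1 \<in> carrier L" "\<not> \<delta> c0 c1" for c0 c1
  proof (rule ccontr)
    assume "\<not> ?thesis"
    then obtain j0 j1 where j: "j0 \<in> M" "j1 \<in> M" "j0 \<squnion> c0 \<in> T" "j1 \<squnion> c1 \<in> T"
      using hits_T c by meson
    have cl: "j0 \<in> carrier L" "j1 \<in> carrier L" "j0 \<squnion> j1 \<in> M" using j Mc join by auto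
    have "j0 \<squnion> c0 \<sqsubseteq> (j0 \<squnion> j1) \<squnion> c0" "j1 \<squnion> c1 \<sqsubseteq> (j0 \<squnion> j1) \<squnion> c1"
      using cl c by (auto intro!: join_mono simp: join_left join_right)
    then have "(j0 \<squnion> j1) \<squnion> c0 \<in> T" "(j0 \<squnion> j1) \<squnion> c1 \<in> T"
      using up[OF j(3)] up[OF j(4)] cl c by auto
    then have "j0 \<squnion> j1 \<in> T"
      using split cl c by auto
    then show False using cl MT by blast
  qed
  moreover have "y \<squnion> z \<in> M \<longleftrightarrow> y \<in> M \<and> z \<in> M" if yz: "y \<in> carrier L" "z \<in> carrier L" for y z
  proof
    assume "y \<squnion> z \<in> M"
    then show "y \<in> M \<and> z \<in> M"
      using down yz join_left[OF yz] join_right[OF yz] by blast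
  qed (use join in blast)
  moreover have "\<bottom> \<in> M" using down xM x(1) by auto
  ultimately have "clan_ideal M"
    using Mc unfolding clan_ideal_def by (intro conjI ballI impI) blast+
  then show ?thesis using xM MT by blast
qed

text \<open>Condition (D1) states that the principal filter of \<open>b\<close> is splitting closed.\<close>

lemma clan_ideal_separating:
  assumes D1: "D1 L \<delta>" and ab: "a \<in> carrier L" "b \<in> carrier L" and "\<not> b \<sqsubseteq> a"
  shows "\<exists>I. clan_ideal I \<and> a \<in> I \<and> b \<notin> I"
proof -
  have "splitting_closed {j. b \<sqsubseteq> j}"
    unfolding splitting_closed_def
  proof (intro conjI ballI impI CollectI; elim CollectE)
    fix x y assume "x \<in> carrier L" "y \<in> carrier L" "b \<sqsubseteq> x" "x \<sqsubseteq> y"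
    then show "b \<sqsubseteq> y" using ab(2) by (meson le_trans)
  qed (use D1 ab in \<open>unfold D1_def, blast\<close>)
  then obtain I where "clan_ideal I" "a \<in> I" "I \<inter> {j. b \<sqsubseteq> j} = {}"
    using clan_ideal_avoiding ab(1) assms(4) by blast
  then show ?thesis using ab by blast
qed

text \<open>
  The set \<open>T\<close> to avoid is generated by \<open>a\<close> and \<open>b\<close> under upward closure and resolution. Instead of the
  generating process, membership of \<open>j\<close> is described by its outcome, a finite set \<open>P\<close> of pairs not in
  contact such that any choice from \<open>P\<close> together with \<open>j\<close> covers \<open>a\<close> or \<open>b\<close>. Two such sets can be
  united, so the resolution rule holds. The sum of \<open>j\<close> with a choice from \<open>P\<close> is replaced by an
  arbitrary upper bound \<open>u\<close>, which avoids finite joins until (D2) is applied to an enumeration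
  of \<open>P\<close>.
\<close>

lemma clan_ideal_omitting_contact_pair:
  assumes D2: "D2 L \<delta>" and ab: "a \<in> carrier L" "b \<in> carrier L" and "\<delta> b a"
  shows "\<exists>I. clan_ideal I \<and> a \<notin> I \<and> b \<notin> I"
proof -
  define N where "N = {(c0, c1). c0 \<in> carrier L \<and> c1 \<in> carrier L \<and> \<not> \<delta> c0 c1}"
  define forces where "forces P j \<longleftrightarrow>
    (\<forall>u\<in>carrier L. j \<sqsubseteq> u \<longrightarrow> (\<forall>(c0, c1)\<in>P. c0 \<sqsubseteq> u \<or> c1 \<sqsubseteq> u) \<longrightarrow> b \<sqsubseteq> u \<or> a \<sqsubseteq> u)" for P j
  define T where "T = {j. \<exists>P\<subseteq>N. finite P \<and> forces P j}"
  have "j \<in> T" if c: "j \<in> carrier L" "c0 \<in> carrier L" "c1 \<in> carrier L" "\<not> \<delta> c0 c1"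
      and jT: "j \<squnion> c0 \<in> T" "j \<squnion> c1 \<in> T" for j c0 c1
  proof -
    obtain P0 where P0: "P0 \<subseteq> N" "finite P0" "forces P0 (j \<squnion> c0)"
      using jT(1) unfolding T_def by blast
    obtain P1 where P1: "P1 \<subseteq> N" "finite P1" "forces P1 (j \<squnion> c1)"
      using jT(2) unfolding T_def by blast
    let ?P = "insert (c0, c1) (P0 \<union> P1)"
    have "?P \<subseteq> N" "finite ?P" using P0(1,2) P1(1,2) c unfolding N_def by auto
    moreover have "forces ?P j"
      unfolding forces_def
    proof (intro ballI impI)
      fix u assume u: "u \<in> carrier L" "j \<sqsubseteq> u" and P: "\<forall>(c0, c1)\<in>?P. c0 \<sqsubseteq> u \<or> c1 \<sqsubseteq> u"
      have "j \<squnion> c0 \<sqsubseteq> u \<or> j \<squnion> c1 \<sqsubseteq> u"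
        using P join_le[OF u(2) _ c(1,2) u(1)] join_le[OF u(2) _ c(1,3) u(1)] by auto
      moreover have "\<forall>(c0, c1)\<in>P0. c0 \<sqsubseteq> u \<or> c1 \<sqsubseteq> u" "\<forall>(c0, c1)\<in>P1. c0 \<sqsubseteq> u \<or> c1 \<sqsubseteq> u"
        using P by simp_all
      ultimately show "b \<sqsubseteq> u \<or> a \<sqsubseteq> u"
        using P0(3) P1(3) u(1) unfolding forces_def by meson
    qed
    ultimately show ?thesis unfolding T_def by blast
  qed
  moreover have "y \<in> T" if xy: "x \<in> carrier L" "y \<in> carrier L" "x \<in> T" "x \<sqsubseteq> y" for x y
  proof -
    have "x \<sqsubseteq> u" if "u \<in> carrier L" "y \<sqsubseteq> u" for u
      using xy(4) that(2) xy(1,2) that(1) by (rule le_trans)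
    then have "forces P y" if "forces P x" for P using that unfolding forces_def by meson
    then show ?thesis using xy(3) unfolding T_def by blast
  qed
  ultimately have "splitting_closed T" unfolding splitting_closed_def by blast
  moreover have "\<bottom> \<notin> T"
  proof
    assume "\<bottom> \<in> T"
    then obtain P where P: "P \<subseteq> N" "finite P" "forces P \<bottom>"
      unfolding T_def by blast
    obtain h where h: "bij_betw h {1..card P} P"
      using ex_bij_betw_nat_finite_1[OF P(2)] by blast
    define c where "c = (\<lambda>i e. if e = (0::nat) then fst (h i) else snd (h i))"
    have hN: "h i \<in> N" if "i \<in> {1..card P}" for i
      using that h P(1) bij_betwE by blast
    have c: "c i 0 \<in> carrier L \<and> c i 1 \<in> carrier L" "\<not> \<delta> (c i 0) (c i 1)"
      if "i \<in> {1..card P}" for i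
      using hN[OF that] unfolding N_def c_def by auto
    have "b \<sqsubseteq> join_upto L (\<lambda>i. c i (f i)) (card P) \<or> a \<sqsubseteq> join_upto L (\<lambda>i. c i (f i)) (card P)"
      if f: "f \<in> {1..card P} \<rightarrow> {0, 1}" for f
    proof (rule P(3)[unfolded forces_def, rule_format])
      let ?u = "join_upto L (\<lambda>i. c i (f i)) (card P)"
      have cf: "c i (f i) \<in> carrier L" if "i \<in> {1..card P}" for i
        using c(1)[OF that] by (auto simp: c_def)
      then show u: "?u \<in> carrier L" by (rule join_upto_closed)
      then show "\<bottom> \<sqsubseteq> ?u" by simp
      fix p assume "p \<in> P"
      then obtain i where i: "i \<in> {1..card P}" "p = h i"
        using h unfolding bij_betw_def by (metis imageE)
      have "c i (f i) \<sqsubseteq> ?u" using cf i(1) join_upto_upper[of "card P" "\<lambda>i. c i (f i)"] by blast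
      then show "case p of (c0, c1) \<Rightarrow> c0 \<sqsubseteq> ?u \<or> c1 \<sqsubseteq> ?u"
        using i(2) by (auto simp: c_def split: prod.splits if_splits)
    qed
    then have "\<not> \<delta> b a"
      using ab c by (intro D2[unfolded D2_def, rule_format, of a b "card P" c]) auto
    then show False using \<open>\<delta> b a\<close> by blast
  qed
  ultimately obtain I where I: "clan_ideal I" "I \<inter> T = {}"
    using clan_ideal_avoiding[of T \<bottom>] by auto
  moreover have "a \<in> T" "b \<in> T"
    unfolding T_def forces_def by (auto intro!: exI[of _ "{}"])
  ultimately show ?thesis by blast
qed

end

section \<open>Powerset lattices\<close>

lemma complete_lattice_powerset: "complete_lattice (powerset_lattice X)"
  unfolding powerset_lattice_def by (rule powerset_is_complete_lattice)

lemma powerset_lattice_simps [simp]: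
  "carrier (powerset_lattice X) = Pow X"
  "(a .=\<^bsub>powerset_lattice X\<^esub> b) = (a = b)"
  "(a \<sqsubseteq>\<^bsub>powerset_lattice X\<^esub> b) = (a \<subseteq> b)"
  "(a \<sqsubset>\<^bsub>powerset_lattice X\<^esub> b) = (a \<subset> b)"
  by (auto simp: powerset_lattice_def lless_def)

lemma join_powerset [simp]:
  assumes "a \<subseteq> X" "b \<subseteq> X"
  shows "a \<squnion>\<^bsub>powerset_lattice X\<^esub> b = a \<union> b"
proof -
  interpret complete_lattice "powerset_lattice X" by (rule complete_lattice_powerset)
  show ?thesis
    using assms join_left[of a b] join_right[of a b] join_le[of a "a \<union> b" b] by auto
qed

lemma meet_powerset [simp]:
  assumes "a \<subseteq> X" "b \<subseteq> X"
  shows "a \<sqinter>\<^bsub>powerset_lattice X\<^esub> b = a \<inter> b"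
proof -
  interpret complete_lattice "powerset_lattice X" by (rule complete_lattice_powerset)
  have "a \<inter> b \<in> Pow X" using assms by blast
  then show ?thesis
    using assms meet_left[of a b] meet_right[of a b] meet_le[of "a \<inter> b" a b] by auto
qed

lemma bottom_powerset [simp]: "\<bottom>\<^bsub>powerset_lattice X\<^esub> = {}"
proof -
  interpret complete_lattice "powerset_lattice X" by (rule complete_lattice_powerset)
  show ?thesis using bottom_lower[of "{}"] by simp
qed

lemma top_powerset [simp]: "\<top>\<^bsub>powerset_lattice X\<^esub> = X"
proof -
  interpret complete_lattice "powerset_lattice X" by (rule complete_lattice_powerset)
  show ?thesis using top_higher[of X] top_closed by simp
qed

lemma complete_atomic_boolean_powerset:
  "complete_atomic_boolean_lattice (powerset_lattice X)"
proof -
  interpret complete_lattice "powerset_lattice X" by (rule complete_lattice_powerset)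
  show ?thesis
  proof unfold_locales
    fix x y z
    assume "x \<in> carrier (powerset_lattice X)" "y \<in> carrier (powerset_lattice X)"
      "z \<in> carrier (powerset_lattice X)"
    then show "x \<sqinter>\<^bsub>powerset_lattice X\<^esub> (y \<squnion>\<^bsub>powerset_lattice X\<^esub> z) =
        (x \<sqinter>\<^bsub>powerset_lattice X\<^esub> y) \<squnion>\<^bsub>powerset_lattice X\<^esub> (x \<sqinter>\<^bsub>powerset_lattice X\<^esub> z)"
      by (simp add: le_infI1 Int_Un_distrib)
  next
    fix x assume "x \<in> carrier (powerset_lattice X)"
    then show "\<exists>y\<in>carrier (powerset_lattice X). x \<sqinter>\<^bsub>powerset_lattice X\<^esub> y = \<bottom>\<^bsub>powerset_lattice X\<^esub> \<and>
        x \<squnion>\<^bsub>powerset_lattice X\<^esub> y = \<top>\<^bsub>powerset_lattice X\<^esub>"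
      by (intro bexI[of _ "X - x"]) auto
  next
    fix x assume "x \<in> carrier (powerset_lattice X)" "x \<noteq> \<bottom>\<^bsub>powerset_lattice X\<^esub>"
    then obtain p where "p \<in> x" "x \<subseteq> X" by auto
    then show "\<exists>p. atom_of (powerset_lattice X) p \<and> p \<sqsubseteq>\<^bsub>powerset_lattice X\<^esub> x"
      by (intro exI[of _ "{p}"]) (auto simp: atom_of_def)
  qed
qed

lemma distrib_powerset: "distrib_lattice_bottom (powerset_lattice X)"
proof -
  interpret complete_atomic_boolean_lattice "powerset_lattice X"
    by (rule complete_atomic_boolean_powerset)
  show ?thesis by unfold_locales
qed

lemma overlap_powerset:
  assumes "a \<subseteq> X" "b \<subseteq> X"
  shows "overlap (powerset_lattice X) a b \<longleftrightarrow> a \<inter> b \<noteq> {}"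
  using assms unfolding overlap_def by (auto intro!: bexI[of _ "a \<inter> b"])

section \<open>Contact relations given by closure operations\<close>

lemma overlap_eq_closure_contact: "overlap L = closure_contact L (\<lambda>x. x)"
  by (simp add: fun_eq_iff overlap_def closure_contact_def)

lemma (in distrib_lattice_bottom) additive_closure_id: "additive_closure L (\<lambda>x. x)"
  by (auto simp: additive_closure_def closure_operation_def isotone_def idempotent_def
      weak_partial_order_axioms)

text \<open>
  Additivity is distributivity applied to a witness: a nonzero \<open>n\<close> below \<open>K b + K c\<close> is the join
  of its meets with \<open>K b\<close> and \<open>K c\<close>, one of which is therefore nonzero.
\<close>

lemma (in distrib_lattice_bottom) additive_contact_closure:
  assumes K: "additive_closure L K"
  shows "additive_contact_semilattice L (closure_contact L K)"
proof -
  have Kc: "K x \<in> carrier L" and Kext: "x \<sqsubseteq> K x" if "x \<in> carrier L" for x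
    using K that by (auto simp: additive_closure_def closure_operation_def)
  have Kmono: "K x \<sqsubseteq> K y" if "x \<in> carrier L" "y \<in> carrier L" "x \<sqsubseteq> y" for x y
    using K that by (auto simp: additive_closure_def closure_operation_def isotone_def)
  have Kjoin: "K (x \<squnion> y) = K x \<squnion> K y" if "x \<in> carrier L" "y \<in> carrier L" for x y
    using K that by (auto simp: additive_closure_def)
  have Kbot: "K \<bottom> = \<bottom>" using K by (auto simp: additive_closure_def)
  have pos: "\<bottom> \<sqsubset> x \<longleftrightarrow> x \<noteq> \<bottom>" if "x \<in> carrier L" for x
    using that by (auto simp: lless_eq)
  have K_pos: "x \<noteq> \<bottom>" if "n \<in> carrier L" "\<bottom> \<sqsubset> n" "n \<sqsubseteq> K x" for n x
    using that Kbot le_antisym[of n \<bottom>] pos by auto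
  show ?thesis
  proof unfold_locales
    fix a b
    assume ab: "a \<in> carrier L" "b \<in> carrier L"
    show "closure_contact L K a b = closure_contact L K b a"
      by (auto simp: closure_contact_def)
    show "\<bottom> \<sqsubset> a \<and> \<bottom> \<sqsubset> b" if "closure_contact L K a b"
      using that ab K_pos pos unfolding closure_contact_def by blast
  next
    fix a b a' b'
    assume "a \<in> carrier L" "b \<in> carrier L" "a' \<in> carrier L" "b' \<in> carrier L"
      "closure_contact L K a b" "a \<sqsubseteq> a'" "b \<sqsubseteq> b'"
    then show "closure_contact L K a' b'"
      unfolding closure_contact_def by (meson Kc Kmono le_trans)
  next
    fix n assume "n \<in> carrier L" "n \<noteq> \<bottom>"
    then show "closure_contact L K n n"
      unfolding closure_contact_def using Kext pos by blast
  next
    fix a b c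
    assume abc: "a \<in> carrier L" "b \<in> carrier L" "c \<in> carrier L"
      and "closure_contact L K a (b \<squnion> c)"
    then obtain n where n: "n \<in> carrier L" "\<bottom> \<sqsubset> n" "n \<sqsubseteq> K a" "n \<sqsubseteq> K b \<squnion> K c"
      unfolding closure_contact_def using Kjoin by auto
    have "n \<sqsubseteq> n \<sqinter> (K b \<squnion> K c)" using n abc Kc by (simp add: meet_le)
    then have "n \<sqsubseteq> (n \<sqinter> K b) \<squnion> (n \<sqinter> K c)"
      using n abc Kc meet_join_distrib by simp
    then have "n \<sqinter> K b \<noteq> \<bottom> \<or> n \<sqinter> K c \<noteq> \<bottom>"
      using n pos le_antisym[of n \<bottom>] le_iff_join_eq[of \<bottom> \<bottom>] by auto
    moreover have "closure_contact L K a d" if d: "n \<sqinter> K d \<noteq> \<bottom>" "d \<in> carrier L" for d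
    proof -
      have "n \<sqinter> K d \<in> carrier L" "n \<sqinter> K d \<sqsubseteq> n" "n \<sqinter> K d \<sqsubseteq> K d"
        using n Kc d(2) by (auto simp: meet_left meet_right)
      moreover from this have "n \<sqinter> K d \<sqsubseteq> K a" using n Kc abc by (meson le_trans)
      ultimately show ?thesis unfolding closure_contact_def using d pos by blast
    qed
    ultimately show "closure_contact L K a b \<or> closure_contact L K a c" using abc by blast
  qed
qed

lemma (in distrib_lattice_bottom) additive_contact_overlap:
  "additive_contact_semilattice L (overlap L)"
  unfolding overlap_eq_closure_contact by (rule additive_contact_closure[OF additive_closure_id])

lemma additive_closure_topological:
  "additive_closure (powerset_lattice (topspace X)) ((closure_of) X)"
proof -
  interpret distrib_lattice_bottom "powerset_lattice (topspace X)" by (rule distrib_powerset)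
  show ?thesis
    unfolding additive_closure_def closure_operation_def isotone_def idempotent_def
    using weak_partial_order_axioms
    by (simp add: closure_of_subset_topspace closure_of_subset closure_of_mono)
qed

lemma topology_contact_eq_closure_contact:
  "topology_contact X = closure_contact (powerset_lattice (topspace X)) ((closure_of) X)"
proof (intro ext iffI)
  fix a b assume "topology_contact X a b"
  then show "closure_contact (powerset_lattice (topspace X)) ((closure_of) X) a b"
    using closure_of_subset_topspace[of X a] unfolding topology_contact_def closure_contact_def
    by (intro bexI[of _ "X closure_of a \<inter> X closure_of b"]) auto
next
  fix a b assume "closure_contact (powerset_lattice (topspace X)) ((closure_of) X) a b"
  then show "topology_contact X a b"
    unfolding topology_contact_def closure_contact_def by auto
qed

section \<open>Additive contact distributive lattices\<close>

locale additive_contact_distrib_lattice =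
  distrib_lattice_bottom L + additive_contact_semilattice L \<delta> for L (structure) and \<delta>
begin

lemma join_meet_le:
  assumes "j \<in> carrier L" "u \<in> carrier L" "v \<in> carrier L"
    and "b \<in> carrier L" "b \<sqsubseteq> j \<squnion> u" "b \<sqsubseteq> j \<squnion> v"
  shows "b \<sqsubseteq> j \<squnion> (u \<sqinter> v)"
proof -
  have "b \<sqsubseteq> (j \<squnion> u) \<sqinter> (j \<squnion> v)" using assms by (simp add: meet_le)
  also have "\<dots> = ((j \<squnion> u) \<sqinter> j) \<squnion> ((j \<squnion> u) \<sqinter> v)" using assms by (simp add: meet_join_distrib)
  also have "(j \<squnion> u) \<sqinter> v = (v \<sqinter> j) \<squnion> (v \<sqinter> u)"
    using assms by (metis meet_comm meet_join_distrib)
  also have "((j \<squnion> u) \<sqinter> j) \<squnion> ((v \<sqinter> j) \<squnion> (v \<sqinter> u)) \<sqsubseteq> j \<squnion> (u \<sqinter> v)"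
    using assms meet_comm[of L v u]
    by (auto intro!: join_le le_trans[OF meet_right join_left] simp: meet_right join_right)
  finally show ?thesis using assms by simp
qed

text \<open>
  In the absence of complements, additivity is used in this form: a contact with \<open>y\<close> can be localized
  to one part of a cover.
\<close>

lemma contact_split:
  assumes "x \<in> carrier L" "y \<in> carrier L" "u \<in> carrier L" "v \<in> carrier L"
    and "\<delta> x y" "x \<sqsubseteq> u \<squnion> v"
  shows "\<exists>z\<in>carrier L. z \<sqsubseteq> x \<and> \<delta> z y \<and> (z \<sqsubseteq> u \<or> z \<sqsubseteq> v)"
proof -
  have "x \<sqsubseteq> x \<sqinter> (u \<squnion> v)" using assms by (simp add: meet_le)
  then have "x \<sqsubseteq> (x \<sqinter> u) \<squnion> (x \<sqinter> v)" using assms by (simp add: meet_join_distrib)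
  then have "\<delta> ((x \<sqinter> u) \<squnion> (x \<sqinter> v)) y" using assms contact_ext[of x y _ y] by auto
  then have "\<delta> (x \<sqinter> u) y \<or> \<delta> (x \<sqinter> v) y"
    using assms contact_additive[of y "x \<sqinter> u" "x \<sqinter> v"] contact_sym by simp
  then show ?thesis using assms by (meson meet_closed meet_left meet_right)
qed

lemma satisfies_D1: "D1 L \<delta>"
  unfolding D1_def
proof (intro ballI impI)
  fix a b c0 c1
  assume c: "a \<in> carrier L" "b \<in> carrier L" "c0 \<in> carrier L" "c1 \<in> carrier L"
    and le: "b \<sqsubseteq> a \<squnion> c0" "b \<sqsubseteq> a \<squnion> c1" and "\<not> \<delta> c0 c1"
  then have "c0 \<sqinter> c1 = \<bottom>"
    using contact_ref[of "c0 \<sqinter> c1"] contact_ext[of "c0 \<sqinter> c1" "c0 \<sqinter> c1" c0 c1]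
    by (auto simp: meet_left meet_right)
  then have "b \<sqsubseteq> a \<squnion> \<bottom>" using join_meet_le[OF c(1,3,4,2) le] by simp
  moreover have "a \<squnion> \<bottom> \<sqsubseteq> a" using c by (auto intro: join_le)
  ultimately show "b \<sqsubseteq> a" using c by (meson bottom_closed join_closed le_trans)
qed

text \<open>
  In a Boolean algebra this is the set of all \<open>j\<close> for which the differences \<open>b - j\<close> and \<open>a - j\<close> are not
  in contact; \<open>p\<close> and \<open>q\<close> replace the differences, which a distributive lattice need not have.
\<close>

definition apart_modulo :: "'a \<Rightarrow> 'a \<Rightarrow> 'a set" where
  "apart_modulo b a =
     {j. \<exists>p\<in>carrier L. \<exists>q\<in>carrier L. b \<sqsubseteq> j \<squnion> p \<and> a \<sqsubseteq> j \<squnion> q \<and> \<not> \<delta> p q}"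

text \<open>
  Let \<open>p0, q0\<close> and \<open>p1, q1\<close> be witnesses modulo \<open>j + c0\<close> and \<open>j + c1\<close>. By distributivity the
  elements \<open>(c0 + p0)(c1 + p1)\<close> and \<open>(c0 + q0)(c1 + q1)\<close> are large enough to serve as witnesses modulo
  \<open>j\<close>. If they were in contact, repeated localization would give \<open>x, y\<close> in contact, each below one
  element of either factor, and in all sixteen cases \<open>c0, c1\<close> or \<open>p0, q0\<close> or \<open>p1, q1\<close> would be in
  contact.
\<close>

lemma splitting_closed_apart_modulo:
  assumes ab: "a \<in> carrier L" "b \<in> carrier L"
  shows "splitting_closed (apart_modulo b a)"
proof -
  let ?T = "apart_modulo b a"
  have "y \<in> ?T" if xy: "x \<in> carrier L" "y \<in> carrier L" "x \<in> ?T" "x \<sqsubseteq> y" for x y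
  proof -
    have mono: "b' \<sqsubseteq> y \<squnion> p" if "b' \<sqsubseteq> x \<squnion> p" "b' \<in> carrier L" "p \<in> carrier L" for b' p
    proof -
      have "x \<squnion> p \<sqsubseteq> y \<squnion> p" using xy that(3) by (simp add: join_mono)
      then show ?thesis using le_trans[OF that(1)] that xy by simp
    qed
    obtain p q where "p \<in> carrier L" "q \<in> carrier L" "b \<sqsubseteq> x \<squnion> p" "a \<sqsubseteq> x \<squnion> q" "\<not> \<delta> p q"
      using xy(3) unfolding apart_modulo_def by blast
    then show ?thesis using mono[of b p] mono[of a q] ab unfolding apart_modulo_def by blast
  qed
  moreover have "j \<in> ?T" if c: "j \<in> carrier L" "c0 \<in> carrier L" "c1 \<in> carrier L" "\<not> \<delta> c0 c1"
    and jT: "j \<squnion> c0 \<in> ?T" "j \<squnion> c1 \<in> ?T" for j c0 c1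
  proof -
    obtain p0 q0 where 0: "p0 \<in> carrier L" "q0 \<in> carrier L"
      "b \<sqsubseteq> (j \<squnion> c0) \<squnion> p0" "a \<sqsubseteq> (j \<squnion> c0) \<squnion> q0" "\<not> \<delta> p0 q0" using jT(1) unfolding apart_modulo_def by blast
    obtain p1 q1 where 1: "p1 \<in> carrier L" "q1 \<in> carrier L"
      "b \<sqsubseteq> (j \<squnion> c1) \<squnion> p1" "a \<sqsubseteq> (j \<squnion> c1) \<squnion> q1" "\<not> \<delta> p1 q1" using jT(2) unfolding apart_modulo_def by blast
    let ?p = "(c0 \<squnion> p0) \<sqinter> (c1 \<squnion> p1)" and ?q = "(c0 \<squnion> q0) \<sqinter> (c1 \<squnion> q1)"
    have "\<not> \<delta> ?p ?q"
    proof
      assume pq: "\<delta> ?p ?q"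
      have cl: "?p \<in> carrier L" "?q \<in> carrier L" using 0 1 c by auto
      have le: "?p \<sqsubseteq> c0 \<squnion> p0" "?p \<sqsubseteq> c1 \<squnion> p1" "?q \<sqsubseteq> c0 \<squnion> q0" "?q \<sqsubseteq> c1 \<squnion> q1"
        using 0 1 c by (auto simp: meet_left meet_right)
      have refine: "\<exists>z\<in>carrier L. \<delta> z y \<and> (z \<sqsubseteq> c0 \<or> z \<sqsubseteq> r0) \<and> (z \<sqsubseteq> c1 \<or> z \<sqsubseteq> r1)"
        if xy: "x \<in> carrier L" "y \<in> carrier L" "r0 \<in> carrier L" "r1 \<in> carrier L" "\<delta> x y"
          "x \<sqsubseteq> c0 \<squnion> r0" "x \<sqsubseteq> c1 \<squnion> r1" for x y r0 r1
      proof -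
        obtain z where z: "z \<in> carrier L" "z \<sqsubseteq> x" "\<delta> z y" "z \<sqsubseteq> c0 \<or> z \<sqsubseteq> r0"
          using contact_split[OF xy(1,2) c(2) xy(3) xy(5,6)] by blast
        moreover have "z \<sqsubseteq> c1 \<squnion> r1" using z xy c by (meson join_closed le_trans)
        ultimately obtain w where w: "w \<in> carrier L" "w \<sqsubseteq> z" "\<delta> w y" "w \<sqsubseteq> c1 \<or> w \<sqsubseteq> r1"
          using contact_split[of z y c1 r1] xy c by blast
        then have "w \<sqsubseteq> c0 \<or> w \<sqsubseteq> r0" using z xy c by (meson le_trans)
        then show ?thesis using w by blast
      qed
      obtain x where x: "x \<in> carrier L" "\<delta> x ?q" "x \<sqsubseteq> c0 \<or> x \<sqsubseteq> p0" "x \<sqsubseteq> c1 \<or> x \<sqsubseteq> p1"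
        using refine[OF cl 0(1) 1(1) pq le(1,2)] by blast
      then have "\<delta> ?q x" using cl contact_sym by blast
      then obtain y where y: "y \<in> carrier L" "\<delta> y x" "y \<sqsubseteq> c0 \<or> y \<sqsubseteq> q0" "y \<sqsubseteq> c1 \<or> y \<sqsubseteq> q1"
        using refine[OF cl(2) x(1) 0(2) 1(2) _ le(3,4)] by blast
      have xy: "\<delta> x y" using x(1) y(1,2) contact_sym by blast
      then have "x \<noteq> \<bottom>" "y \<noteq> \<bottom>" using contact_emp[OF x(1) y(1)] by (auto simp: lless_eq)
      then have "\<delta> x x" "\<delta> y y" using x(1) y(1) contact_ref by blast+
      then have "\<not> (x \<sqsubseteq> c0 \<and> x \<sqsubseteq> c1)" "\<not> (y \<sqsubseteq> c0 \<and> y \<sqsubseteq> c1)"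
        using contact_ext[OF x(1) x(1) c(2,3)] contact_ext[OF y(1) y(1) c(2,3)] c(4) by blast+
      moreover have "\<not> (x \<sqsubseteq> p0 \<and> y \<sqsubseteq> q0)" "\<not> (x \<sqsubseteq> p1 \<and> y \<sqsubseteq> q1)"
        using contact_ext[OF x(1) y(1) 0(1,2) xy] contact_ext[OF x(1) y(1) 1(1,2) xy] 0(5) 1(5)
        by blast+
      moreover have "\<not> (x \<sqsubseteq> c0 \<and> y \<sqsubseteq> c1)" "\<not> (y \<sqsubseteq> c0 \<and> x \<sqsubseteq> c1)"
        using contact_ext[OF x(1) y(1) c(2,3) xy] contact_ext[OF y(1) x(1) c(2,3) y(2)] c(4)
        by blast+
      ultimately show False using x(3,4) y(3,4) by blast
    qed
    moreover have "b' \<sqsubseteq> j \<squnion> ((c0 \<squnion> r0) \<sqinter> (c1 \<squnion> r1))"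
      if "b' \<sqsubseteq> (j \<squnion> c0) \<squnion> r0" "b' \<sqsubseteq> (j \<squnion> c1) \<squnion> r1"
        "r0 \<in> carrier L" "r1 \<in> carrier L" "b' \<in> carrier L" for b' r0 r1
      using that c by (auto intro!: join_meet_le simp: join_assoc)
    ultimately show ?thesis
      unfolding apart_modulo_def using 0 1 ab c by (intro CollectI bexI[of _ ?p] bexI[of _ ?q] conjI) simp_all
  qed
  ultimately show ?thesis unfolding splitting_closed_def by blast
qed

lemma satisfies_D2: "D2 L \<delta>"
  unfolding D2_def
proof (intro allI ballI impI)
  fix n a b and c :: "nat \<Rightarrow> nat \<Rightarrow> 'a"
  assume ab: "a \<in> carrier L" "b \<in> carrier L"
    and c: "\<forall>i\<in>{1..n}. c i 0 \<in> carrier L \<and> c i 1 \<in> carrier L"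
    and nc: "\<forall>i\<in>{1..n}. \<not> \<delta> (c i 0) (c i 1)"
    and cover: "\<forall>f \<in> {1..n} \<rightarrow> {0, 1}.
      b \<sqsubseteq> join_upto L (\<lambda>i. c i (f i)) n \<or> a \<sqsubseteq> join_upto L (\<lambda>i. c i (f i)) n"
  let ?T = "apart_modulo b a"
  have bot: "\<not> \<delta> \<bottom> x" "\<not> \<delta> x \<bottom>" if "x \<in> carrier L" for x
    using contact_emp that by (auto simp: lless_eq)
  have T: "j \<in> ?T" if j: "j \<in> carrier L" "b \<sqsubseteq> j \<or> a \<sqsubseteq> j" for j
    using j(2)
  proof
    assume "b \<sqsubseteq> j"
    then have "b \<sqsubseteq> j \<squnion> \<bottom>" "a \<sqsubseteq> j \<squnion> a"
      using le_trans[of b j "j \<squnion> \<bottom>"] j(1) ab by (simp_all add: join_left join_right)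
    then show ?thesis using ab bot(1) unfolding apart_modulo_def by blast
  next
    assume "a \<sqsubseteq> j"
    then have "b \<sqsubseteq> j \<squnion> b" "a \<sqsubseteq> j \<squnion> \<bottom>"
      using le_trans[of a j "j \<squnion> \<bottom>"] j(1) ab by (simp_all add: join_left join_right)
    then show ?thesis using ab bot(2) unfolding apart_modulo_def by blast
  qed
  have "join_upto L (\<lambda>i. c i (f i)) n \<in> ?T" if f: "f \<in> {1..n} \<rightarrow> {0, 1}" for f
  proof (rule T)
    show "join_upto L (\<lambda>i. c i (f i)) n \<in> carrier L"
    proof (rule join_upto_closed)
      fix i assume i: "i \<in> {1..n}"
      then have "f i = 0 \<or> f i = 1" using f by blast
      then show "c i (f i) \<in> carrier L" using c i by auto
    qed
  qed (use cover f in blast)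
  then have "\<bottom> \<in> ?T"
    using bottom_in_splitting_closed[OF splitting_closed_apart_modulo[OF ab] c nc] by blast
  then obtain p q where pq: "p \<in> carrier L" "q \<in> carrier L"
    "b \<sqsubseteq> \<bottom> \<squnion> p" "a \<sqsubseteq> \<bottom> \<squnion> q" "\<not> \<delta> p q"
    unfolding apart_modulo_def by blast
  moreover have "\<bottom> \<squnion> p = p" "\<bottom> \<squnion> q = q" using pq le_iff_join_eq[of \<bottom>] by auto
  ultimately have "b \<sqsubseteq> p" "a \<sqsubseteq> q" by simp_all
  then show "\<not> \<delta> b a" using pq ab contact_ext by blast
qed

end

section \<open>Embeddings\<close>

lemma D1_D2_embeddable:
  assumes S: "weak_contact_semilattice S \<delta>" and T: "weak_contact_semilattice T \<epsilon>"
    and "embeddable S \<delta> T \<epsilon>" and D: "D1 T \<epsilon>" "D2 T \<epsilon>"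
  shows "D1 S \<delta> \<and> D2 S \<delta>"
proof -
  interpret S: weak_contact_semilattice S \<delta> by (rule S)
  interpret T: weak_contact_semilattice T \<epsilon> by (rule T)
  obtain \<phi> where \<phi>: "\<phi> \<in> carrier S \<rightarrow> carrier T" "inj_on \<phi> (carrier S)" "\<phi> \<bottom>\<^bsub>S\<^esub> = \<bottom>\<^bsub>T\<^esub>"
    "\<And>a b. a \<in> carrier S \<Longrightarrow> b \<in> carrier S \<Longrightarrow> \<phi> (a \<squnion>\<^bsub>S\<^esub> b) = \<phi> a \<squnion>\<^bsub>T\<^esub> \<phi> b"
    "\<And>a b. a \<in> carrier S \<Longrightarrow> b \<in> carrier S \<Longrightarrow> \<epsilon> (\<phi> a) (\<phi> b) \<longleftrightarrow> \<delta> a b"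
    using assms(3) unfolding embeddable_def contact_embedding_def by blast
  have cl: "\<phi> a \<in> carrier T" if "a \<in> carrier S" for a using \<phi>(1) that by blast
  have le: "\<phi> a \<sqsubseteq>\<^bsub>T\<^esub> \<phi> b \<longleftrightarrow> a \<sqsubseteq>\<^bsub>S\<^esub> b" if "a \<in> carrier S" "b \<in> carrier S" for a b
    using that cl \<phi>(2) by (simp add: S.le_iff_join_eq T.le_iff_join_eq inj_on_eq_iff flip: \<phi>(4))
  have "D1 S \<delta>"
    unfolding D1_def
  proof (intro ballI impI)
    fix a b c0 c1
    assume "a \<in> carrier S" "b \<in> carrier S" "c0 \<in> carrier S" "c1 \<in> carrier S"
      "b \<sqsubseteq>\<^bsub>S\<^esub> a \<squnion>\<^bsub>S\<^esub> c0" "b \<sqsubseteq>\<^bsub>S\<^esub> a \<squnion>\<^bsub>S\<^esub> c1" "\<not> \<delta> c0 c1"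
    then have "\<phi> b \<sqsubseteq>\<^bsub>T\<^esub> \<phi> a"
      using D(1) cl unfolding D1_def by (metis S.join_closed \<phi>(4,5) le)
    then show "b \<sqsubseteq>\<^bsub>S\<^esub> a" using le \<open>a \<in> carrier S\<close> \<open>b \<in> carrier S\<close> by blast
  qed
  moreover have "D2 S \<delta>"
    unfolding D2_def
  proof (intro allI ballI impI)
    fix n a b and c :: "nat \<Rightarrow> nat \<Rightarrow> 'a"
    assume ab: "a \<in> carrier S" "b \<in> carrier S"
      and c: "\<forall>i\<in>{1..n}. c i 0 \<in> carrier S \<and> c i 1 \<in> carrier S"
      and nc: "\<forall>i\<in>{1..n}. \<not> \<delta> (c i 0) (c i 1)"
      and cover: "\<forall>f \<in> {1..n} \<rightarrow> {0, 1}.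
        b \<sqsubseteq>\<^bsub>S\<^esub> join_upto S (\<lambda>i. c i (f i)) n \<or> a \<sqsubseteq>\<^bsub>S\<^esub> join_upto S (\<lambda>i. c i (f i)) n"
    have join: "\<phi> (join_upto S g m) = join_upto T (\<lambda>i. \<phi> (g i)) m"
      if "\<And>i. i \<in> {1..m} \<Longrightarrow> g i \<in> carrier S" for g m
      using that
    proof (induction m)
      case (Suc m)
      then have "join_upto S g m \<in> carrier S" by (intro S.join_upto_closed) auto
      then show ?case using Suc by (auto simp: \<phi>(4))
    qed (simp add: \<phi>(3))
    have "\<phi> b \<sqsubseteq>\<^bsub>T\<^esub> join_upto T (\<lambda>i. \<phi> (c i (f i))) n \<or> \<phi> a \<sqsubseteq>\<^bsub>T\<^esub> join_upto T (\<lambda>i. \<phi> (c i (f i))) n"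
      if f: "f \<in> {1..n} \<rightarrow> {0, 1}" for f
    proof -
      have cf: "c i (f i) \<in> carrier S" if i: "i \<in> {1..n}" for i
      proof -
        have "f i = 0 \<or> f i = 1" using f i by blast
        then show ?thesis using c i by auto
      qed
      then have "join_upto S (\<lambda>i. c i (f i)) n \<in> carrier S" by (rule S.join_upto_closed)
      then show ?thesis using cover f ab le join[of n "\<lambda>i. c i (f i)"] cf by metis
    qed
    then have "\<not> \<epsilon> (\<phi> b) (\<phi> a)"
      using D(2)[unfolded D2_def, rule_format, of "\<phi> a" "\<phi> b" n "\<lambda>i e. \<phi> (c i e)"]
        ab c nc cl \<phi>(5) by auto
    then show "\<not> \<delta> b a" using \<phi>(5) ab by blast
  qed
  ultimately show ?thesis ..
qed

lemma embeddable_contact_cong: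
  assumes "\<And>a b. a \<in> carrier T \<Longrightarrow> b \<in> carrier T \<Longrightarrow> \<epsilon> a b \<longleftrightarrow> \<epsilon>' a b"
  shows "embeddable S \<delta> T \<epsilon> \<longleftrightarrow> embeddable S \<delta> T \<epsilon>'"
  using assms unfolding embeddable_def contact_embedding_def by (auto simp: Pi_iff)

text \<open>
  The points are copies of the clan ideals under \<open>pt\<close>, so that the set of points can be placed in
  whatever type is required.
\<close>

lemma (in weak_contact_semilattice) embeddable_powerset:
  assumes D: "D1 L \<delta>" "D2 L \<delta>" and pt: "inj_on pt {I. clan_ideal I}"
  shows "embeddable L \<delta> (powerset_lattice (pt ` {I. clan_ideal I}))
           (overlap (powerset_lattice (pt ` {I. clan_ideal I})))"
proof -
  define \<phi> where "\<phi> a = pt ` {I. clan_ideal I \<and> a \<notin> I}" for a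
  let ?X = "pt ` {I. clan_ideal I}"
  have sub: "\<phi> a \<subseteq> ?X" for a unfolding \<phi>_def by blast
  have mem: "pt I \<in> \<phi> a \<longleftrightarrow> a \<notin> I" if "clan_ideal I" for I a
    using that pt unfolding \<phi>_def inj_on_def by blast
  have "inj_on \<phi> (carrier L)"
  proof (rule inj_onI)
    fix a b assume ab: "a \<in> carrier L" "b \<in> carrier L" "\<phi> a = \<phi> b"
    then have "a \<sqsubseteq> b" "b \<sqsubseteq> a" using clan_ideal_separating[OF D(1)] mem by metis+
    then show "a = b" using ab by (simp add: le_antisym)
  qed
  moreover have "\<phi> \<bottom> = {}" unfolding \<phi>_def clan_ideal_def by blast
  moreover have "\<phi> (a \<squnion> b) = \<phi> a \<union> \<phi> b" if "a \<in> carrier L" "b \<in> carrier L" for a b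
    using that unfolding \<phi>_def clan_ideal_def by blast
  moreover have "\<delta> a b \<longleftrightarrow> \<phi> a \<inter> \<phi> b \<noteq> {}" if ab: "a \<in> carrier L" "b \<in> carrier L" for a b
  proof
    assume "\<delta> a b"
    then obtain I where "clan_ideal I" "a \<notin> I" "b \<notin> I"
      using clan_ideal_omitting_contact_pair[OF D(2) ab(2,1)] by blast
    then show "\<phi> a \<inter> \<phi> b \<noteq> {}" using mem by blast
  next
    assume "\<phi> a \<inter> \<phi> b \<noteq> {}"
    then obtain I where "clan_ideal I" "a \<notin> I" "b \<notin> I"
      using mem unfolding \<phi>_def by blast
    then show "\<delta> a b" using ab unfolding clan_ideal_def by blast
  qed
  ultimately have "contact_embedding L \<delta> (powerset_lattice ?X) (overlap (powerset_lattice ?X)) \<phi>"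
    unfolding contact_embedding_def using sub by (simp add: overlap_powerset)
  then show ?thesis unfolding embeddable_def by blast
qed

section \<open>The equivalence\<close>

lemma complete_atomic_overlap_imp_boolean_overlap:
  "embeds_complete_atomic_overlap U S \<delta> \<Longrightarrow> embeds_boolean_overlap U S \<delta>"
  unfolding embeds_complete_atomic_overlap_def embeds_boolean_overlap_def
  using complete_atomic_boolean_lattice.axioms(1) by blast

lemma boolean_overlap_imp_boolean_additive:
  "embeds_boolean_overlap U S \<delta> \<Longrightarrow> embeds_boolean_additive U S \<delta>"
  unfolding embeds_boolean_overlap_def embeds_boolean_additive_def
  using boolean_lattice.axioms(1) distrib_lattice_bottom.additive_contact_overlap by blast

lemma boolean_overlap_imp_distrib_overlap:
  "embeds_boolean_overlap U S \<delta> \<Longrightarrow> embeds_distrib_overlap U S \<delta>"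
  unfolding embeds_distrib_overlap_def embeds_boolean_overlap_def
  using boolean_lattice.axioms(1) by blast

lemma boolean_additive_imp_distrib_additive:
  "embeds_boolean_additive U S \<delta> \<Longrightarrow> embeds_distrib_additive U S \<delta>"
  unfolding embeds_distrib_additive_def embeds_boolean_additive_def
  using boolean_lattice.axioms(1) by blast

lemma distrib_overlap_imp_distrib_closure:
  "embeds_distrib_overlap U S \<delta> \<Longrightarrow> embeds_distrib_closure U S \<delta>"
  unfolding embeds_distrib_overlap_def embeds_distrib_closure_def overlap_eq_closure_contact
  using distrib_lattice_bottom.additive_closure_id by blast

text \<open>
  The powerset of the space is one type level above its points; this is why the direction
  from embeddings to (D1) and (D2) is proved for targets in an arbitrary type.
\<close>

lemma topological_imp_distrib_closure:
  "embeds_topological TYPE('u) S \<delta> \<Longrightarrow> embeds_distrib_closure TYPE('u set) S \<delta>"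
  unfolding embeds_topological_def embeds_distrib_closure_def topology_contact_eq_closure_contact
  using distrib_powerset additive_closure_topological by blast

lemma distrib_closure_imp_distrib_additive:
  "embeds_distrib_closure U S \<delta> \<Longrightarrow> embeds_distrib_additive U S \<delta>"
  unfolding embeds_distrib_additive_def embeds_distrib_closure_def
  using distrib_lattice_bottom.additive_contact_closure by blast

lemma distrib_additive_imp_D1_D2:
  assumes "weak_contact_semilattice S \<delta>" and "embeds_distrib_additive U S \<delta>"
  shows "D1 S \<delta> \<and> D2 S \<delta>"
proof -
  obtain L :: "'c gorder" and \<epsilon> where "distrib_lattice_bottom L"
    and L: "additive_contact_semilattice L \<epsilon>" and emb: "embeddable S \<delta> L \<epsilon>"
    using assms(2) unfolding embeds_distrib_additive_def by blast
  then interpret L: additive_contact_distrib_lattice L \<epsilon>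
    by (intro additive_contact_distrib_lattice.intro)
  show ?thesis
    using D1_D2_embeddable[OF assms(1) L.weak_contact_semilattice_axioms emb]
      L.satisfies_D1 L.satisfies_D2 by blast
qed

lemma D1_D2_imp_complete_atomic_overlap:
  fixes S :: "('a, 'm) gorder_scheme"
  assumes "weak_contact_semilattice S \<delta>" "D1 S \<delta>" "D2 S \<delta>"
  shows "embeds_complete_atomic_overlap TYPE('a set set) S \<delta>"
proof -
  interpret weak_contact_semilattice S \<delta> by (rule assms)
  show ?thesis
    unfolding embeds_complete_atomic_overlap_def
    using embeddable_powerset[OF assms(2,3), of "\<lambda>I. I"] complete_atomic_boolean_powerset
    by auto
qed

text \<open>
  In a discrete space the contact is overlap. The points have to be taken from \<open>'a set set\<close>, whereas
  clan ideals are elements of \<open>'a set\<close>, hence the singletons.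
\<close>

lemma D1_D2_imp_topological:
  fixes S :: "('a, 'm) gorder_scheme"
  assumes "weak_contact_semilattice S \<delta>" "D1 S \<delta>" "D2 S \<delta>"
  shows "embeds_topological TYPE('a set set) S \<delta>"
proof -
  interpret weak_contact_semilattice S \<delta> by (rule assms)
  let ?X = "(\<lambda>I. {I}) ` {I. clan_ideal I}"
  have "embeddable S \<delta> (powerset_lattice ?X) (overlap (powerset_lattice ?X))"
    using embeddable_powerset[OF assms(2,3), of "\<lambda>I. {I}"] by simp
  moreover have "overlap (powerset_lattice ?X) a b \<longleftrightarrow> topology_contact (discrete_topology ?X) a b"
    if "a \<in> carrier (powerset_lattice ?X)" "b \<in> carrier (powerset_lattice ?X)" for a b
  proof -
    have "discrete_topology ?X closure_of a = a" "discrete_topology ?X closure_of b = b"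
      using that by (simp_all add: discrete_topology_closure_of Int_absorb1)
    then show ?thesis using that by (simp add: overlap_powerset topology_contact_def)
  qed
  ultimately have "embeddable S \<delta> (powerset_lattice ?X) (topology_contact (discrete_topology ?X))"
    using embeddable_contact_cong by blast
  then show ?thesis
    unfolding embeds_topological_def by (metis topspace_discrete_topology)
qed

lemma embedding_imp_D1_D2:
  assumes S: "weak_contact_semilattice S \<delta>"
    and "embeds_boolean_overlap TYPE('u) S \<delta> \<or> embeds_boolean_additive TYPE('u) S \<delta> \<or>
      embeds_distrib_overlap TYPE('u) S \<delta> \<or> embeds_distrib_additive TYPE('u) S \<delta> \<or>
      embeds_complete_atomic_overlap TYPE('u) S \<delta> \<or> embeds_topological TYPE('u) S \<delta> \<or>
      embeds_distrib_closure TYPE('u) S \<delta>"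
  shows "D1 S \<delta> \<and> D2 S \<delta>"
proof -
  have "embeds_distrib_additive TYPE('u) S \<delta> \<or> embeds_distrib_additive TYPE('u set) S \<delta>"
    using assms(2) complete_atomic_overlap_imp_boolean_overlap[of "TYPE('u)" S \<delta>]
      boolean_overlap_imp_boolean_additive[of "TYPE('u)" S \<delta>]
      boolean_additive_imp_distrib_additive[of "TYPE('u)" S \<delta>]
      distrib_overlap_imp_distrib_closure[of "TYPE('u)" S \<delta>]
      topological_imp_distrib_closure[of S \<delta>, where ?'u = 'u]
      distrib_closure_imp_distrib_additive[of "TYPE('u)" S \<delta>]
      distrib_closure_imp_distrib_additive[of "TYPE('u set)" S \<delta>]
    by blast
  then show ?thesis
    using distrib_additive_imp_D1_D2[OF S, of "TYPE('u)"]
      distrib_additive_imp_D1_D2[OF S, of "TYPE('u set)"] by blast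
qed

theorem theorem3p2:
  fixes S :: "('a, 'm) gorder_scheme" and \<delta> :: "'a \<Rightarrow> 'a \<Rightarrow> bool"
  assumes "weak_contact_semilattice S \<delta>"
  shows "(embeds_boolean_overlap TYPE('a set set) S \<delta> \<longleftrightarrow> D1 S \<delta> \<and> D2 S \<delta>) \<and>
         (embeds_boolean_additive TYPE('a set set) S \<delta> \<longleftrightarrow> D1 S \<delta> \<and> D2 S \<delta>) \<and>
         (embeds_distrib_overlap TYPE('a set set) S \<delta> \<longleftrightarrow> D1 S \<delta> \<and> D2 S \<delta>) \<and>
         (embeds_distrib_additive TYPE('a set set) S \<delta> \<longleftrightarrow> D1 S \<delta> \<and> D2 S \<delta>) \<and>
         (embeds_complete_atomic_overlap TYPE('a set set) S \<delta> \<longleftrightarrow> D1 S \<delta> \<and> D2 S \<delta>) \<and>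
         (embeds_topological TYPE('a set set) S \<delta> \<longleftrightarrow> D1 S \<delta> \<and> D2 S \<delta>) \<and>
         (embeds_distrib_closure TYPE('a set set) S \<delta> \<longleftrightarrow> D1 S \<delta> \<and> D2 S \<delta>) \<and>
         (embeds_boolean_overlap TYPE('u) S \<delta> \<longrightarrow> D1 S \<delta> \<and> D2 S \<delta>) \<and>
         (embeds_boolean_additive TYPE('u) S \<delta> \<longrightarrow> D1 S \<delta> \<and> D2 S \<delta>) \<and>
         (embeds_distrib_overlap TYPE('u) S \<delta> \<longrightarrow> D1 S \<delta> \<and> D2 S \<delta>) \<and>
         (embeds_distrib_additive TYPE('u) S \<delta> \<longrightarrow> D1 S \<delta> \<and> D2 S \<delta>) \<and>
         (embeds_complete_atomic_overlap TYPE('u) S \<delta> \<longrightarrow> D1 S \<delta> \<and> D2 S \<delta>) \<and>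
         (embeds_topological TYPE('u) S \<delta> \<longrightarrow> D1 S \<delta> \<and> D2 S \<delta>) \<and>
         (embeds_distrib_closure TYPE('u) S \<delta> \<longrightarrow> D1 S \<delta> \<and> D2 S \<delta>)"
proof -
  have complete: "embeds_complete_atomic_overlap TYPE('a set set) S \<delta>"
    "embeds_topological TYPE('a set set) S \<delta>" if "D1 S \<delta> \<and> D2 S \<delta>"
    using that assms D1_D2_imp_complete_atomic_overlap D1_D2_imp_topological by blast+
  have boolean: "embeds_boolean_overlap TYPE('a set set) S \<delta>" if "D1 S \<delta> \<and> D2 S \<delta>"
    using complete(1)[OF that] by (rule complete_atomic_overlap_imp_boolean_overlap)
  have closure: "embeds_distrib_closure TYPE('a set set) S \<delta>" if "D1 S \<delta> \<and> D2 S \<delta>"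
    using boolean_overlap_imp_distrib_overlap[OF boolean[OF that]]
    by (rule distrib_overlap_imp_distrib_closure)
  note sound = embedding_imp_D1_D2[OF assms, where ?'u = "'a set set"]
    embedding_imp_D1_D2[OF assms, where ?'u = 'u]
  show ?thesis
    using sound complete boolean closure boolean_overlap_imp_boolean_additive[OF boolean]
      boolean_overlap_imp_distrib_overlap[OF boolean]
      distrib_closure_imp_distrib_additive[OF closure] by blast
qed

end
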